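(* Let $P$ be a polygon with a dissection $D$, and let $K$ be a semifield. A map $f : \operatorname{diag}(P) \to K$ is a weak frieze with respect to $D$ if and only if it satisfies the $T$-path formula with respect to $D$, i.e. if and only if for all vertices $\alpha \neq \beta$ of $P$, \[ f(\alpha,\beta) = \sum_{\pi \in \mathcal{T}_{P,D}(\alpha,\beta)} f(\pi). \]
   Context: A semifield is a set $K$ with binary operations $+$ and $\cdot$ such that $+$ is associative and commutative, $(K,\cdot)$ is a commutative group (unit $1_K$, inverse $x^{-1}$), and $\cdot$ distributes over $+$; no additive identity or subtraction is assumed. Write $x/y := xy^{-1}$. A polygon $P$ is a finite set $V$ of at least three vertices equipped with a cyclic order; we picture it as a convex polygon in the Euclidean plane whose vertices appear anticlockwise in this cyclic order. A diagonal of $P$ is a two-element subset $\{\alpha,\beta\}$ of $V$ (so edges $\{\alpha,\alpha^+\}$, with $\alpha^+$ the successor of $\alpha$, count as diagonals); $\operatorname{diag}(P)$ is the set of diagonals. Diagonals that are not edges are internal. Diagonals $\{\alpha,\beta\}$ and $\{\gamma,\delta\}$ cross if $\alpha,\beta,\gamma,\delta$ are four distinct vertices appearing in the cyclic order as $\alpha,\gamma,\beta,\delta$ or $\alpha,\delta,\beta,\gamma$. A dissection of $P$ is a (possibly empty) set of pairwise non-crossing internal diagonals. For $f:\operatorname{diag}(P)\to K$ write $f(\alpha,\beta):=f(\{\alpha,\beta\})$. $f$ is a weak frieze with respect to a dissection $D$ if $f(\alpha,\beta)f(\gamma,\delta) = f(\alpha,\gamma)f(\beta,\delta) + f(\alpha,\delta)f(\beta,\gamma)$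 (the Ptolemy relation) whenever $\{\alpha,\beta\}$ and $\{\gamma,\delta\}$ are crossing diagonals with $\{\gamma,\delta\} \in D$. For vertices $\pi_1 \neq \pi_p$, a $T$-path from $\pi_1$ to $\pi_p$ with respect to $D$ is an ordered tuple $\pi=(\pi_1,\dots,\pi_p)$ of vertices such that: (i) $\{\pi_1,\pi_2\},\dots,\{\pi_{p-1},\pi_p\}$ are pairwise different diagonals; (ii) no $\{\pi_i,\pi_{i+1}\}$ crosses a diagonal in $D$; (iii) every diagonal $\{\pi_{2j},\pi_{2j+1}\}$ lies in $D$, and these diagonals cross the segment $\{\pi_1,\pi_p\}$ (in the convex realization) at pairwise different points which progress monotonically in the direction from $\pi_1$ to $\pi_p$. $\mathcal{T}_{P,D}(\alpha,\beta)$ denotes the set of $T$-paths from $\alpha$ to $\beta$ with respect to $D$. For a $T$-path $\pi$, $f(\pi) := \prod_{i \text{ odd}} f(\pi_i,\pi_{i+1}) \big/ \prod_{j \text{ even}} f(\pi_j,\pi_{j+1})$ (indices $1\le i,j\le p-1$). *)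

theory Defs
  imports Complex_Main
begin

class psemifield = comm_semiring + comm_monoid_mult + inverse +
  assumes psemifield_left_inverse: "inverse a * a = 1"
  assumes psemifield_divide: "a / b = a * inverse b"

text \<open>Sum over a finite nonempty set in a commutative additive semigroup
  (no zero needed): pick an element and fold the rest.\<close>

definition ssum :: "('a \<Rightarrow> 'k::ab_semigroup_add) \<Rightarrow> 'a set \<Rightarrow> 'k" where
  "ssum g A = (let a = (SOME a. a \<in> A)
               in Finite_Set.fold (\<lambda>x y. g x + y) (g a) (A - {a}))"

text \<open>The polygon P has vertex set {0..<n} (n \<ge> 3) with cyclic order
  k \<mapsto> (k+1) mod n, i.e. vertices are labelled anticlockwise.\<close>

definition cbetween :: "nat \<Rightarrow> nat \<Rightarrow> nat \<Rightarrow> nat \<Rightarrow> bool" where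
  "cbetween n a x b \<longleftrightarrow> x \<noteq> a \<and> (x + n - a) mod n < (b + n - a) mod n"

definition crosses :: "nat \<Rightarrow> nat \<Rightarrow> nat \<Rightarrow> nat \<Rightarrow> nat \<Rightarrow> bool" where
  "crosses n a b c d \<longleftrightarrow> a < n \<and> b < n \<and> c < n \<and> d < n \<and> distinct [a, b, c, d] \<and>
     ((cbetween n a c b \<and> cbetween n b d a) \<or> (cbetween n a d b \<and> cbetween n b c a))"

definition diag :: "nat \<Rightarrow> nat set set" where
  "diag n = {{a, b} | a b. a < n \<and> b < n \<and> a \<noteq> b}"

definition cross_diag :: "nat \<Rightarrow> nat set \<Rightarrow> nat set \<Rightarrow> bool" where
  "cross_diag n e e' \<longleftrightarrow> (\<exists>a b c d. e = {a, b} \<and> e' = {c, d} \<and> crosses n a b c d)"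

definition internal_diag :: "nat \<Rightarrow> nat set set" where
  "internal_diag n = {e \<in> diag n. \<forall>a. a < n \<longrightarrow> e \<noteq> {a, (a + 1) mod n}}"

definition dissection :: "nat \<Rightarrow> nat set set \<Rightarrow> bool" where
  "dissection n D \<longleftrightarrow> D \<subseteq> internal_diag n \<and> (\<forall>e\<in>D. \<forall>e'\<in>D. \<not> cross_diag n e e')"

definition weak_frieze :: "nat \<Rightarrow> nat set set \<Rightarrow> (nat set \<Rightarrow> 'k::psemifield) \<Rightarrow> bool" where
  "weak_frieze n D f \<longleftrightarrow>
     (\<forall>\<alpha> \<beta> \<gamma> \<delta>. crosses n \<alpha> \<beta> \<gamma> \<delta> \<and> {\<gamma>, \<delta>} \<in> D \<longrightarrow>
        f {\<alpha>, \<beta>} * f {\<gamma>, \<delta>} = f {\<alpha>, \<gamma>} * f {\<beta>, \<delta>} + f {\<alpha>, \<delta>} * f {\<beta>, \<gamma>})"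

definition vpt :: "nat \<Rightarrow> nat \<Rightarrow> complex" where
  "vpt n k = cis (2 * pi * real k / real n)"

definition cross2 :: "complex \<Rightarrow> complex \<Rightarrow> real" where
  "cross2 z w = Im (cnj z * w)"

text \<open>Parameter t of the intersection point vpt a + t (vpt b - vpt a) of the segment
  from a to b with the line through c and d (t = 0 at a, t = 1 at b).\<close>

definition cross_param :: "nat \<Rightarrow> nat \<Rightarrow> nat \<Rightarrow> nat \<Rightarrow> nat \<Rightarrow> real" where
  "cross_param n a b c d =
     cross2 (vpt n c - vpt n a) (vpt n d - vpt n c) / cross2 (vpt n b - vpt n a) (vpt n d - vpt n c)"

text \<open>A T-path (\<pi>_1,...,\<pi>_p) is the list ps with \<pi>_i = ps ! (i-1); its i-th step
  {\<pi>_i, \<pi>_(i+1)} is step k = i-1 (0-based). Paper-even steps are 0-based odd steps.\<close>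

definition step :: "nat list \<Rightarrow> nat \<Rightarrow> nat set" where
  "step ps k = {ps ! k, ps ! Suc k}"

definition is_Tpath :: "nat \<Rightarrow> nat set set \<Rightarrow> nat \<Rightarrow> nat \<Rightarrow> nat list \<Rightarrow> bool" where
  "is_Tpath n D \<alpha> \<beta> ps \<longleftrightarrow>
     \<alpha> \<noteq> \<beta> \<and> 2 \<le> length ps \<and> hd ps = \<alpha> \<and> last ps = \<beta> \<and> set ps \<subseteq> {..<n} \<and>
     \<comment> \<open>(i) the steps are pairwise different diagonals\<close>
     (\<forall>k < length ps - 1. step ps k \<in> diag n) \<and>
     distinct (map (step ps) [0..<length ps - 1]) \<and>
     \<comment> \<open>(ii) no step crosses a diagonal of D\<close>
     (\<forall>k < length ps - 1. \<forall>e\<in>D. \<not> cross_diag n (step ps k) e) \<and>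
     \<comment> \<open>(iii) even steps lie in D, cross {\<alpha>,\<beta>}, at points progressing from \<alpha> to \<beta>\<close>
     (\<forall>k < length ps - 1. odd k \<longrightarrow> step ps k \<in> D \<and> cross_diag n (step ps k) {\<alpha>, \<beta>}) \<and>
     (\<forall>k k'. k < k' \<and> k' < length ps - 1 \<and> odd k \<and> odd k' \<longrightarrow>
        cross_param n \<alpha> \<beta> (ps ! k) (ps ! Suc k) < cross_param n \<alpha> \<beta> (ps ! k') (ps ! Suc k'))"

definition Tpaths :: "nat \<Rightarrow> nat set set \<Rightarrow> nat \<Rightarrow> nat \<Rightarrow> nat list set" where
  "Tpaths n D \<alpha> \<beta> = {ps. is_Tpath n D \<alpha> \<beta> ps}"

definition fpath :: "(nat set \<Rightarrow> 'k::psemifield) \<Rightarrow> nat list \<Rightarrow> 'k" where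
  "fpath f ps =
     (\<Prod>k \<in> {k. k < length ps - 1 \<and> even k}. f (step ps k)) /
     (\<Prod>k \<in> {k. k < length ps - 1 \<and> odd k}. f (step ps k))"

end

theory Submission
  imports Defs
begin

text \<open>Let \<open>{\<gamma>, \<delta>}\<close> be the diagonal of \<open>D\<close> crossing \<open>{\<alpha>, \<beta>}\<close> closest to \<open>\<beta>\<close>. The last even step of a
  \<open>T\<close>-path from \<open>\<alpha>\<close> to \<open>\<beta>\<close> ends in \<open>\<gamma>\<close> or \<open>\<delta>\<close>. The paths ending in \<open>\<delta>, \<beta>\<close> arise bijectively from the
  \<open>T\<close>-paths from \<open>\<alpha>\<close> to \<open>\<gamma>\<close> by appending \<open>\<delta>, \<beta>\<close> and, if this creates a backtrack \<open>\<delta>, \<gamma>, \<delta>\<close>, contracting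
  it to \<open>\<delta>\<close>; symmetrically for \<open>\<gamma>, \<beta>\<close>. Hence the sums over \<open>T\<close>-paths satisfy the Ptolemy relation for
  this diagonal. Induction on the number of diagonals of \<open>D\<close> crossing \<open>{\<alpha>, \<beta>}\<close> then shows that a weak frieze
  satisfies the \<open>T\<close>-path formula. For the converse the same induction extends the Ptolemy relation to every
  diagonal of \<open>D\<close> crossing \<open>{\<alpha>, \<beta>}\<close>: expand along the closest one, apply the induction hypothesis to the
  factors, and cancel.\<close>

section \<open>Semifields and nonempty sums\<close>

lemma psf_cancel: "a * c = b * c \<longleftrightarrow> a = b" for a b c :: "'k::psemifield"
proof
  assume "a * c = b * c"
  then have "a * (inverse c * c) = b * (inverse c * c)"
    by (metis mult.assoc mult.commute)
  then show "a = b" by (simp add: psemifield_left_inverse)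
qed simp

lemma psf_inverse_mult: "inverse (a * b) = inverse a * inverse b" for a b :: "'k::psemifield"
proof -
  have "inverse (a * b) * (a * b) = (inverse a * a) * (inverse b * b)"
    by (simp add: psemifield_left_inverse)
  also have "\<dots> = (inverse a * inverse b) * (a * b)"
    by (simp only: mult.assoc mult.left_commute mult.commute)
  finally show ?thesis by (simp only: psf_cancel)
qed

lemma psf_inverse_one: "inverse 1 = (1 :: 'k::psemifield)"
  by (metis mult.right_neutral psemifield_left_inverse)

lemma psf_divide_mult: "a / b * b = a" for a b :: "'k::psemifield"
  by (simp add: psemifield_divide mult.assoc psemifield_left_inverse)

text \<open>Commuting one value between the seed and the folded set shows that the choice made by
  \<open>SOME\<close> does not affect the result.\<close>

lemma ssum_eq_fold:
  assumes "finite A" "a \<in> A"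
  shows "ssum g A = Finite_Set.fold (\<lambda>x y. g x + y) (g a) (A - {a})"
proof -
  interpret comp_fun_commute_on UNIV "\<lambda>x y. g x + y"
    by standard (auto simp: fun_eq_iff add.left_commute)
  define b where "b = (SOME a. a \<in> A)"
  have b: "b \<in> A" unfolding b_def by (rule someI[of _ a]) (fact assms)
  have "Finite_Set.fold (\<lambda>x y. g x + y) (g a) (A - {a})
      = Finite_Set.fold (\<lambda>x y. g x + y) (g b) (A - {b})" if "a \<noteq> b"
  proof -
    define C where "C = A - {a, b}"
    have C: "finite C" "a \<notin> C" "b \<notin> C" "A - {a} = insert b C" "A - {b} = insert a C"
      using assms b that by (auto simp: C_def)
    have "Finite_Set.fold (\<lambda>x y. g x + y) (g a) (insert b C)
        = Finite_Set.fold (\<lambda>x y. g x + y) (g b + g a) C"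
      using C by (simp add: fold_insert fold_fun_left_comm)
    also have "\<dots> = Finite_Set.fold (\<lambda>x y. g x + y) (g b) (insert a C)"
      using C by (simp add: fold_insert fold_fun_left_comm add.commute[of "g b" "g a"])
    finally show ?thesis using C by simp
  qed
  then show ?thesis unfolding ssum_def Let_def b_def[symmetric] by metis
qed

lemma ssum_singleton: "ssum g {a} = g a"
  by (simp add: ssum_def)

lemma ssum_insert:
  assumes "finite A" "A \<noteq> {}" "a \<notin> A"
  shows "ssum g (insert a A) = g a + ssum g A"
proof -
  interpret comp_fun_commute_on UNIV "\<lambda>x y. g x + y"
    by standard (auto simp: fun_eq_iff add.left_commute)
  obtain b where b: "b \<in> A" using assms by auto
  have "insert a A - {b} = insert a (A - {b})" using b assms by auto
  then have "ssum g (insert a A) = Finite_Set.fold (\<lambda>x y. g x + y) (g b) (insert a (A - {b}))"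
    using ssum_eq_fold[of "insert a A" b g] b assms by auto
  also have "\<dots> = g a + ssum g A"
    using ssum_eq_fold[of A b g] assms b by simp
  finally show ?thesis .
qed

lemma ssum_cong:
  assumes "finite A" "A \<noteq> {}" "\<And>x. x \<in> A \<Longrightarrow> g x = h x"
  shows "ssum g A = ssum h A"
  using assms by (induction rule: finite_ne_induct) (auto simp: ssum_singleton ssum_insert)

lemma ssum_union:
  assumes "finite A" "A \<noteq> {}" "finite B" "B \<noteq> {}" "A \<inter> B = {}"
  shows "ssum g (A \<union> B) = ssum g A + ssum g B"
  using assms
  by (induction rule: finite_ne_induct) (auto simp: ssum_singleton ssum_insert add.assoc)

lemma ssum_image:
  assumes "finite A" "A \<noteq> {}" "inj_on h A"
  shows "ssum g (h ` A) = ssum (\<lambda>x. g (h x)) A"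
  using assms
  by (induction rule: finite_ne_induct) (auto simp: ssum_singleton ssum_insert)

lemma ssum_mult_right:
  fixes g :: "'a \<Rightarrow> 'k::psemifield"
  assumes "finite A" "A \<noteq> {}"
  shows "ssum (\<lambda>x. g x * c) A = ssum g A * c"
  using assms
  by (induction rule: finite_ne_induct) (auto simp: ssum_singleton ssum_insert distrib_right)

section \<open>Crossing in linear coordinates\<close>

definition between :: "nat \<Rightarrow> nat \<Rightarrow> nat \<Rightarrow> bool" where
  "between a b c \<longleftrightarrow> a < c \<and> c < b \<or> b < c \<and> c < a"

definition interlace :: "nat \<Rightarrow> nat \<Rightarrow> nat \<Rightarrow> nat \<Rightarrow> bool" where
  "interlace a b c d \<longleftrightarrow> distinct [a, b, c, d] \<and> between a b c \<noteq> between a b d"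

text \<open>Cutting the cyclic order at the vertex \<open>r\<close> makes it linear; crossing does not depend on \<open>r\<close>.\<close>

definition pos :: "nat \<Rightarrow> nat \<Rightarrow> nat \<Rightarrow> nat" where
  "pos n r x = (x + n - r) mod n"

lemma pos_eq: "x < n \<Longrightarrow> r < n \<Longrightarrow> pos n r x = (if r \<le> x then x - r else x + n - r)"
  by (auto simp: pos_def mod_if)

lemma pos_less: "r < n \<Longrightarrow> pos n r x < n"
  by (simp add: pos_def)

lemma pos_self: "r < n \<Longrightarrow> pos n r r = 0"
  by (simp add: pos_def)

lemma pos_inject: "x < n \<Longrightarrow> y < n \<Longrightarrow> r < n \<Longrightarrow> pos n r x = pos n r y \<longleftrightarrow> x = y"
  by (auto simp: pos_eq split: if_splits)

lemma cbetween_iff: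
  assumes "a < n" "b < n" "x < n"
  shows "cbetween n a x b \<longleftrightarrow> a < x \<and> x < b \<or> b < a \<and> a < x \<or> x < b \<and> b < a"
proof -
  have "(y + n - a) mod n = (if a \<le> y then y - a else y + n - a)" if "y < n" for y
    using pos_eq[OF that assms(1)] by (simp add: pos_def)
  then show ?thesis using assms by (auto simp: cbetween_def)
qed

text \<open>Away from \<open>a\<close> and \<open>b\<close> the arcs from \<open>a\<close> to
  \<open>b\<close> and from \<open>b\<close> to \<open>a\<close> are complementary, so crossing
  means that exactly one of \<open>c\<close>, \<open>d\<close> lies on the first arc. Passing from
  the arc to \<open>between\<close> negates both memberships or neither, according to the order of
  \<open>a\<close> and \<open>b\<close>.\<close>

lemma crosses_iff_interlace_0:
  "crosses n a b c d \<longleftrightarrow> a < n \<and> b < n \<and> c < n \<and> d < n \<and> interlace a b c d"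
proof (cases "a < n \<and> b < n \<and> c < n \<and> d < n \<and> distinct [a, b, c, d]")
  case True
  have c: "cbetween n b x a \<longleftrightarrow> \<not> cbetween n a x b" "between a b x \<longleftrightarrow> (a < b) = cbetween n a x b"
    if "x = c \<or> x = d" for x
  proof -
    have "x < n" "x \<noteq> a" "x \<noteq> b" "a \<noteq> b" using True that by auto
    moreover have "a < n" "b < n" using True by auto
    ultimately show "cbetween n b x a \<longleftrightarrow> \<not> cbetween n a x b" "between a b x \<longleftrightarrow> (a < b) = cbetween n a x b"
      by (auto simp add: cbetween_iff between_def)
  qed
  show ?thesis
    using True c[of c] c[of d] unfolding crosses_def interlace_def by blast
qed (auto simp: crosses_def interlace_def)

text \<open>Moving the cut to \<open>r\<close> flips betweenness for every third vertex if exactly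
  one of \<open>a\<close>, \<open>b\<close> is below \<open>r\<close>, and for none otherwise;
  comparing two such values is unaffected.\<close>

lemma interlace_pos:
  assumes "a < n" "b < n" "c < n" "d < n" "r < n"
  shows "interlace (pos n r a) (pos n r b) (pos n r c) (pos n r d) \<longleftrightarrow> interlace a b c d"
proof (cases "distinct [a, b, c, d]")
  case True
  have "between (pos n r a) (pos n r b) (pos n r x) \<longleftrightarrow> (((a < r) = (b < r)) = between a b x)"
    if "x < n" "x \<noteq> a" "x \<noteq> b" "a \<noteq> b" for x
    using assms that
    by (cases "r \<le> a"; cases "r \<le> b"; cases "r \<le> x") (simp_all add: between_def pos_eq, linarith+)
  from this[of c] this[of d] show ?thesis
    using True assms by (simp add: interlace_def pos_inject) blast
qed (use assms in \<open>auto simp: interlace_def pos_inject\<close>)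

lemma crosses_iff_interlace:
  assumes "r < n"
  shows "crosses n a b c d \<longleftrightarrow> a < n \<and> b < n \<and> c < n \<and> d < n \<and>
     interlace (pos n r a) (pos n r b) (pos n r c) (pos n r d)"
  using interlace_pos[of a n b c d r] assms by (auto simp: crosses_iff_interlace_0)

lemma interlace_swap:
  "interlace b a c d = interlace a b c d"
  "interlace a b d c = interlace a b c d"
  "interlace c d a b = interlace a b c d"
proof -
  show "interlace b a c d = interlace a b c d" "interlace a b d c = interlace a b c d"
    by (auto simp: interlace_def between_def)
  show "interlace c d a b = interlace a b c d"
  proof (cases "distinct [a, b, c, d]")
    case True
    then show ?thesis
      by (cases a b rule: linorder_cases; cases c d rule: linorder_cases)
        (simp_all add: interlace_def between_def, linarith+)
  qed (auto simp: interlace_def)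
qed

lemma crosses_swap:
  "crosses n b a c d = crosses n a b c d"
  "crosses n a b d c = crosses n a b c d"
  "crosses n c d a b = crosses n a b c d"
  unfolding crosses_iff_interlace_0
  using interlace_swap[of a b c d] by blast+

lemma cross_diag_iff: "cross_diag n {a, b} {c, d} \<longleftrightarrow> crosses n a b c d"
proof
  assume "cross_diag n {a, b} {c, d}"
  then obtain a' b' c' d' where "{a, b} = {a', b'}" "{c, d} = {c', d'}" "crosses n a' b' c' d'"
    by (auto simp: cross_diag_def)
  then show "crosses n a b c d"
    by (metis doubleton_eq_iff crosses_swap(1,2))
qed (auto simp: cross_diag_def)

section \<open>Intersection points of chords\<close>

text \<open>Counting from \<open>r\<close> is a rotation of the regular polygon; a wrap-around costs
  one full turn.\<close>

lemma vpt_pos: "x < n \<Longrightarrow> r < n \<Longrightarrow> vpt n x = vpt n r * vpt n (pos n r x)"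
proof -
  assume x: "x < n" and r: "r < n"
  then have n: "real n \<noteq> 0" by simp
  show ?thesis
  proof (cases "r \<le> x")
    case True
    then show ?thesis using x r n
      by (simp add: vpt_def pos_eq cis_mult of_nat_diff add_divide_distrib[symmetric] algebra_simps)
  next
    case False
    then have "real r + real (x + n - r) = real x + real n" using r by linarith
    then have "2 * pi * real r / real n + 2 * pi * real (x + n - r) / real n
       = 2 * pi * (real x + real n) / real n"
      by (metis add_divide_distrib distrib_left)
    also have "\<dots> = 2 * pi * real x / real n + 2 * pi"
      using n by (simp add: field_simps)
    finally show ?thesis using False x r
      by (simp add: vpt_def pos_eq cis_mult complex_eq_iff)
  qed
qed

lemma cross2_rotate: "cmod k = 1 \<Longrightarrow> cross2 (k * z) (k * w) = cross2 z w"
proof -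
  assume "cmod k = 1"
  then have "cnj k * k = 1" by (metis complex_norm_square mult.commute of_real_1 power_one)
  then have "cnj (k * z) * (k * w) = cnj z * w"
    by (metis (no_types, opaque_lifting) complex_cnj_mult mult.left_commute mult.assoc mult.left_neutral)
  then show ?thesis unfolding cross2_def by (rule arg_cong)
qed

text \<open>In half-angles, the chord from \<open>cis (2 * y)\<close> to \<open>cis (2 * x)\<close>
  has signed length \<open>2 * sin (x - y)\<close> and direction \<open>x + y\<close> plus a right
  angle, so cross products of chords factor into sines.\<close>

lemma cross2_chords:
  "cross2 (cis (2 * c) - 1) (cis (2 * d) - cis (2 * c)) = 4 * sin c * sin d * sin (d - c)"
  "cross2 (cis (2 * b) - 1) (cis (2 * d) - cis (2 * c)) = 4 * sin b * sin (c + d - b) * sin (d - c)"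
proof -
  have *: "cis (2 * x) - cis (2 * y) = 2 * \<i> * of_real (sin (x - y)) * cis (x + y)" for x y
  proof -
    have "cis (2 * x) - cis (2 * y) = cis (x + y) * (cis (x - y) - cis (y - x))"
      by (simp add: right_diff_distrib cis_mult algebra_simps)
    also have "cis (x - y) - cis (y - x) = 2 * \<i> * of_real (sin (x - y))"
      by (simp add: complex_eq_iff cos_diff sin_diff)
    finally show ?thesis by simp
  qed
  have **: "cis (2 * x) - 1 = 2 * \<i> * of_real (sin x) * cis x" for x
    using *[of x 0] by simp
  have c2: "cross2 (2 * \<i> * of_real s * cis x) (2 * \<i> * of_real t * cis y) = 4 * s * t * sin (y - x)"
    for s t x y :: real
    by (simp add: cross2_def sin_diff algebra_simps)
  show "cross2 (cis (2 * c) - 1) (cis (2 * d) - cis (2 * c)) = 4 * sin c * sin d * sin (d - c)"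
    unfolding * ** c2 by (simp add: algebra_simps)
  show "cross2 (cis (2 * b) - 1) (cis (2 * d) - cis (2 * c)) = 4 * sin b * sin (c + d - b) * sin (d - c)"
    unfolding * ** c2 by (simp add: algebra_simps)
qed

text \<open>After rotating \<open>a\<close> to 1, the vertices \<open>c\<close>, \<open>b\<close>,
  \<open>d\<close> have half-angles \<open>x\<close>, \<open>z\<close>, \<open>y\<close>. The common
  factor \<open>sin (y - x)\<close> cancels, and product-to-sum formulas turn the denominator
  \<open>sin z * sin (x + y - z)\<close> into a sum of positive terms. Swapping \<open>c\<close> and
  \<open>d\<close> changes the sign of both cross products.\<close>

lemma cross_param_pos:
  assumes "a < n" "b < n" "c < n" "d < n" "0 < pos n a c" "pos n a c < pos n a b" "pos n a b < pos n a d"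
  defines "x \<equiv> pi * real (pos n a c) / real n" and "y \<equiv> pi * real (pos n a d) / real n"
    and "z \<equiv> pi * real (pos n a b) / real n"
  shows "cross_param n a b c d = sin x * sin y / (sin x * sin y + sin (z - x) * sin (y - z))"
    and "cross_param n a b d c = cross_param n a b c d"
    and "0 < x" "x < z" "z < y" "y < pi"
proof -
  have n: "real n > 0" using assms(1) by simp
  show o: "0 < x" "x < z" "z < y" "y < pi"
    using n assms(5-7) pos_less[OF assms(1), of d] by (auto simp: x_def y_def z_def field_simps)
  have V: "vpt n c = vpt n a * cis (2 * x)" "vpt n d = vpt n a * cis (2 * y)"
    "vpt n b = vpt n a * cis (2 * z)"
    unfolding vpt_pos[OF assms(2,1)] vpt_pos[OF assms(3,1)] vpt_pos[OF assms(4,1)]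
    by (simp_all add: x_def y_def z_def vpt_def mult.assoc)
  have v: "vpt n c - vpt n a = vpt n a * (cis (2 * x) - 1)"
    "vpt n d - vpt n a = vpt n a * (cis (2 * y) - 1)"
    "vpt n b - vpt n a = vpt n a * (cis (2 * z) - 1)"
    "vpt n d - vpt n c = vpt n a * (cis (2 * y) - cis (2 * x))"
    "vpt n c - vpt n d = vpt n a * (cis (2 * x) - cis (2 * y))"
    unfolding V by (simp_all add: right_diff_distrib)
  have u: "cmod (vpt n a) = 1" by (simp add: vpt_def)
  have s: "sin (y - x) > 0" using o by (intro sin_gt_zero) auto
  have s': "sin (x - y) < 0" using s by (metis minus_diff_eq neg_0_less_iff_less sin_minus)
  have "2 * z - x - y = (z - x) - (y - z)" "z - x + (y - z) = y - x" by simp_all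
  then have "cos (2 * z - x - y) = cos ((z - x) - (y - z))" "cos (x - y) = cos (z - x + (y - z))"
    using cos_minus[of "x - y"] by (simp_all only: minus_diff_eq)
  moreover have "sin z * sin (x + y - z) = (cos (2 * z - x - y) - cos (x + y)) / 2"
  proof -
    have "z - (x + y - z) = 2 * z - x - y" "z + (x + y - z) = x + y" by simp_all
    then show ?thesis by (simp only: sin_times_sin)
  qed
  ultimately have id: "sin z * sin (x + y - z) = sin x * sin y + sin (z - x) * sin (y - z)"
    by (simp add: sin_times_sin diff_divide_distrib)
  have e: "cross_param n a b c d = sin x * sin y / (sin z * sin (x + y - z))"
    unfolding cross_param_def v cross2_rotate[OF u] cross2_chords using s by simp
  then show "cross_param n a b c d = sin x * sin y / (sin x * sin y + sin (z - x) * sin (y - z))"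
    using id by simp
  have "cross_param n a b d c = sin x * sin y / (sin z * sin (x + y - z))"
    unfolding cross_param_def v cross2_rotate[OF u] cross2_chords using s' by (simp add: add.commute)
  then show "cross_param n a b d c = cross_param n a b c d" using e by simp
qed

text \<open>Each ratio is of the form \<open>1 / (1 + s t)\<close> with \<open>s = sin (z - x) / sin x\<close> decreasing in \<open>x\<close> and
  \<open>t = sin (y - z) / sin y\<close> increasing in \<open>y\<close>.\<close>

lemma chord_ratio_less:
  fixes x :: real
  assumes "0 < x" "x \<le> x'" "x' < z" "z < y'" "y' \<le> y" "y < pi" "x \<noteq> x' \<or> y \<noteq> y'"
  shows "sin x * sin y / (sin x * sin y + sin (z - x) * sin (y - z))
       < sin x' * sin y' / (sin x' * sin y' + sin (z - x') * sin (y' - z))"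
proof -
  have pos: "sin x > 0" "sin y > 0" "sin x' > 0" "sin y' > 0" "sin z > 0"
    "sin (z - x) > 0" "sin (z - x') > 0" "sin (y - z) > 0" "sin (y' - z) > 0"
    using assms by (auto intro!: sin_gt_zero)
  \<comment> \<open>\<open>X\<close> and \<open>Y\<close> express the monotonicity of the two ratios
    without division.\<close>
  have X: "sin (z - x) * sin x' - sin (z - x') * sin x = sin z * sin (x' - x)"
    by (simp add: sin_diff algebra_simps)
  have Y: "sin (y - z) * sin y' - sin (y' - z) * sin y = sin z * sin (y - y')"
    by (simp add: sin_diff algebra_simps)
  have X0: "sin (z - x') * sin x \<le> sin (z - x) * sin x'"
  proof -
    have "0 \<le> sin z * sin (x' - x)"
      using assms pos by (intro mult_nonneg_nonneg sin_ge_zero) auto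
    then show ?thesis using X by linarith
  qed
  have Y0: "sin (y' - z) * sin y \<le> sin (y - z) * sin y'"
  proof -
    have "0 \<le> sin z * sin (y - y')"
      using assms pos by (intro mult_nonneg_nonneg sin_ge_zero) auto
    then show ?thesis using Y by linarith
  qed
  have X1: "sin (z - x') * sin x < sin (z - x) * sin x'" if "x \<noteq> x'"
  proof -
    have "0 < sin z * sin (x' - x)"
      using assms pos that by (intro mult_pos_pos sin_gt_zero) auto
    then show ?thesis using X by linarith
  qed
  have Y1: "sin (y' - z) * sin y < sin (y - z) * sin y'" if "y \<noteq> y'"
  proof -
    have "0 < sin z * sin (y - y')"
      using assms pos that by (intro mult_pos_pos sin_gt_zero) auto
    then show ?thesis using Y by linarith
  qed
  have "(sin (z - x') * sin x) * (sin (y' - z) * sin y) < (sin (z - x) * sin x') * (sin (y - z) * sin y')"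
  proof (cases "x = x'")
    case False
    show ?thesis by (rule mult_less_le_imp_less) (use False X1 Y0 pos in auto)
  next
    case True
    show ?thesis by (rule mult_le_less_imp_less) (use True X0 Y1 assms(7) pos in auto)
  qed
  then have "sin x * sin y * (sin x' * sin y' + sin (z - x') * sin (y' - z))
           < sin x' * sin y' * (sin x * sin y + sin (z - x) * sin (y - z))"
    by (simp add: algebra_simps)
  moreover have "sin x * sin y + sin (z - x) * sin (y - z) > 0"
    "sin x' * sin y' + sin (z - x') * sin (y' - z) > 0"
    using pos by (auto intro!: add_pos_pos mult_pos_pos)
  ultimately show ?thesis by (simp add: divide_less_eq less_divide_eq mult.commute)
qed

lemma cross_param_less:
  assumes "a < n" "b < n" "c < n" "d < n" "c' < n" "d' < n"
    and "0 < pos n a c" "pos n a c \<le> pos n a c'" "pos n a c' < pos n a b"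
    and "pos n a b < pos n a d'" "pos n a d' \<le> pos n a d" "{c, d} \<noteq> {c', d'}"
  shows "cross_param n a b c d < cross_param n a b c' d'"
proof -
  have n: "real n > 0" using assms(1) by simp
  have ne: "pos n a c \<noteq> pos n a c' \<or> pos n a d \<noteq> pos n a d'"
    using assms by (auto simp: pos_inject)
  note ord = cross_param_pos[of a n b c d] cross_param_pos[of a n b c' d']
  have "pi * real (pos n a c) / real n \<le> pi * real (pos n a c') / real n"
    "pi * real (pos n a d') / real n \<le> pi * real (pos n a d) / real n"
    using assms n by (auto intro!: divide_right_mono)
  moreover have "pi * real (pos n a c) / real n \<noteq> pi * real (pos n a c') / real n \<or>
    pi * real (pos n a d) / real n \<noteq> pi * real (pos n a d') / real n"
    using ne n by simp
  ultimately show ?thesis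
    using assms ord chord_ratio_less by simp
qed

section \<open>T-paths\<close>

text \<open>Paths are kept as reversed lists, so that extending a path is list construction; the step
  added to \<open>x # q\<close> has 0-based index \<open>length q\<close>, and odd indices are the even steps of the paper.\<close>

fun steps :: "nat list \<Rightarrow> nat set set" where
  "steps (y # x # q) = insert {x, y} (steps (x # q))"
| "steps _ = {}"

fun odd_steps :: "nat list \<Rightarrow> nat set set" where
  "odd_steps (y # x # q) = (if odd (length q) then {{x, y}} else {}) \<union> odd_steps (x # q)"
| "odd_steps _ = {}"

fun weight :: "(nat set \<Rightarrow> 'k::psemifield) \<Rightarrow> nat list \<Rightarrow> 'k" where
  "weight f (y # x # q) =
    (if odd (length q) then weight f (x # q) / f {x, y} else weight f (x # q) * f {x, y})"
| "weight f _ = 1"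

lemma step_append:
  "k < length q \<Longrightarrow> step (q @ [x, y]) k = step (q @ [x]) k"
  "step (q @ [x, y]) (length q) = {x, y}"
  by (auto simp: step_def nth_append less_Suc_eq)

lemma steps_rev: "steps r = step (rev r) ` {k. k < length r - 1}"
proof (induction r rule: steps.induct)
  case (1 y x q)
  have "{k. k < Suc (length q)} = insert (length q) {k. k < length q}" by auto
  then show ?case
    using 1 by (auto simp: step_append(2)[of "rev q", simplified] step_append(1)[of _ "rev q", simplified])
qed auto

lemma odd_steps_rev: "odd_steps r = step (rev r) ` {k. k < length r - 1 \<and> odd k}"
proof (induction r rule: odd_steps.induct)
  case (1 y x q)
  have "{k. k < Suc (length q) \<and> odd k} =
    (if odd (length q) then {length q} else {}) \<union> {k. k < length q \<and> odd k}" by (auto simp: less_Suc_eq)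
  then show ?case
    using 1 by (auto simp: step_append(2)[of "rev q", simplified] step_append(1)[of _ "rev q", simplified])
qed auto

lemma fpath_rev: "fpath f (rev r) = weight f r"
proof (induction r rule: steps.induct)
  case (1 y x q)
  have ev: "{k. k < Suc (length q) \<and> even k} =
    (if even (length q) then insert (length q) {k. k < length q \<and> even k} else {k. k < length q \<and> even k})"
    and od: "{k. k < Suc (length q) \<and> odd k} =
    (if odd (length q) then insert (length q) {k. k < length q \<and> odd k} else {k. k < length q \<and> odd k})"
    by (auto simp: less_Suc_eq)
  have st: "step (rev q @ [x, y]) (length q) = {x, y}" using step_append(2)[of "rev q"] by simp
  have pr: "(\<Prod>k\<in>{k. k < length q \<and> P k}. f (step (rev q @ [x, y]) k))
     = (\<Prod>k\<in>{k. k < length q \<and> P k}. f (step (rev q @ [x]) k))" for P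
    by (intro prod.cong) (auto simp: step_append(1)[of _ "rev q", simplified])
  show ?case
    using 1 by (simp add: fpath_def ev od st pr psemifield_divide psf_inverse_mult ac_simps)
next
  case "2_1"
  then show ?case by (simp add: fpath_def psemifield_divide psf_inverse_one)
next
  case ("2_2" v)
  then show ?case by (simp add: fpath_def psemifield_divide psf_inverse_one)
qed

lemma steps_subset_set: "e \<in> steps r \<Longrightarrow> e \<subseteq> set r"
  by (induction r rule: steps.induct) auto

lemma finite_steps: "finite (steps r)"
  by (induction r rule: steps.induct) auto

lemma diag_iff: "{x, y} \<in> diag n \<longleftrightarrow> x < n \<and> y < n \<and> x \<noteq> y"
  by (auto simp: diag_def doubleton_eq_iff)

lemma finite_diag: "finite (diag n)"
proof -
  have "diag n \<subseteq> Pow {..<n}" by (auto simp: diag_def)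
  then show ?thesis by (rule finite_subset) simp
qed

section \<open>Dissected polygons in linear coordinates from the start vertex\<close>

locale dissected_polygon =
  fixes n :: nat and D :: "nat set set" and a :: nat
  assumes dissection: "dissection n D" and base: "a < n"
begin

abbreviation p :: "nat \<Rightarrow> nat" where "p \<equiv> pos n a"

lemma D_diag: "D \<subseteq> diag n"
  using dissection by (auto simp: dissection_def internal_diag_def)

lemma D_doubleton: "{u, v} \<in> D \<Longrightarrow> u < n \<and> v < n \<and> u \<noteq> v"
  using D_diag diag_iff by blast

lemma D_no_cross: "e \<in> D \<Longrightarrow> e' \<in> D \<Longrightarrow> \<not> cross_diag n e e'"
  using dissection by (auto simp: dissection_def)

lemma p_base: "p a = 0"
  by (simp add: pos_self base)

lemma p_eq: "x < n \<Longrightarrow> y < n \<Longrightarrow> p x = p y \<longleftrightarrow> x = y"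
  by (simp add: pos_inject base)

lemma crosses_p:
  "crosses n u v x y \<longleftrightarrow> u < n \<and> v < n \<and> x < n \<and> y < n \<and> interlace (p u) (p v) (p x) (p y)"
  by (rule crosses_iff_interlace) (rule base)

lemma crosses_base:
  assumes "u < n" "v < n" "x < n"
  shows "crosses n u v a x \<longleftrightarrow> 0 < p u \<and> p u < p x \<and> p x < p v \<or> 0 < p v \<and> p v < p x \<and> p x < p u"
  using assms base by (auto simp: crosses_p p_base interlace_def between_def)

lemma cross_baseE:
  assumes "e \<in> D" "cross_diag n e {a, x}"
  obtains u v where "e = {u, v}" "u < n" "v < n" "x < n" "0 < p u" "p u < p x" "p x < p v"
proof -
  obtain u v where e: "e = {u, v}" using assms D_diag by (auto simp: diag_def)
  then have c: "crosses n u v a x" using assms by (simp add: cross_diag_iff)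
  then have *: "u < n" "v < n" "x < n" by (auto simp: crosses_p)
  show ?thesis
    using c crosses_base[OF *] that[of u v] that[of v u] * e by (auto simp: insert_commute)
qed

lemma cross_baseI:
  "u < n \<Longrightarrow> v < n \<Longrightarrow> x < n \<Longrightarrow> 0 < p u \<Longrightarrow> p u < p x \<Longrightarrow> p x < p v \<Longrightarrow> cross_diag n {u, v} {a, x}"
  by (simp add: cross_diag_iff crosses_base)

text \<open>Non-crossing diagonals that cross \<open>{a, b}\<close> do so in the order from \<open>a\<close> to \<open>b\<close> exactly if each
  separates the later ones from \<open>a\<close>. Unlike the intersection parameter, this does not depend on \<open>b\<close>.\<close>

definition encloses :: "nat set \<Rightarrow> nat set \<Rightarrow> bool" where
  "encloses e e' \<longleftrightarrow> (\<forall>y\<in>e'. (\<exists>x\<in>e. p x \<le> p y) \<and> (\<exists>x\<in>e. p y \<le> p x))"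

lemma encloses_iff: "p u < p v \<Longrightarrow> encloses {u, v} {x, y} \<longleftrightarrow>
    p u \<le> p x \<and> p x \<le> p v \<and> p u \<le> p y \<and> p y \<le> p v"
  by (auto simp: encloses_def)

text \<open>Intervals with a common inner point \<open>w\<close> could fail to be nested only by
  interlacing, which the dissection forbids.\<close>

lemma encloses_total:
  assumes "{u, v} \<in> D" "{x, y} \<in> D" "p u < w" "w < p v" "p x < w" "w < p y"
  shows "p u \<le> p x \<and> p y \<le> p v \<or> p x \<le> p u \<and> p v \<le> p y"
proof -
  have "\<not> interlace (p u) (p v) (p x) (p y)"
    using D_no_cross[OF assms(1,2)] D_doubleton[OF assms(1)] D_doubleton[OF assms(2)]
    by (simp add: cross_diag_iff crosses_p)
  then show ?thesis using assms by (auto simp: interlace_def between_def)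
qed

text \<open>Both diagonals are first oriented so that their ends straddle \<open>b\<close>, which
  leaves the parameters unchanged. By \<open>encloses_total\<close> they are nested one way or the
  other, and \<open>cross_param_less\<close> gives a strict inequality in either case.\<close>

lemma cross_param_less_iff:
  assumes "{u, v} \<in> D" "{x, y} \<in> D" "{u, v} \<noteq> {x, y}"
    and "cross_diag n {u, v} {a, b}" "cross_diag n {x, y} {a, b}"
  shows "cross_param n a b u v < cross_param n a b x y \<longleftrightarrow> encloses {u, v} {x, y}"
proof -
  have main: "cross_param n a b u v < cross_param n a b x y \<longleftrightarrow> encloses {u, v} {x, y}"
    if *: "{u, v} \<in> D" "{x, y} \<in> D" "{u, v} \<noteq> {x, y}"
      "0 < p u" "p u < p b" "p b < p v" "0 < p x" "p x < p b" "p b < p y" "b < n" for u v x y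
  proof -
    have n: "u < n" "v < n" "x < n" "y < n" using D_doubleton * by auto
    have "p u \<le> p x \<and> p y \<le> p v \<Longrightarrow> cross_param n a b u v < cross_param n a b x y"
      using * n base by (intro cross_param_less) auto
    moreover have "p x \<le> p u \<and> p v \<le> p y \<Longrightarrow> cross_param n a b x y < cross_param n a b u v"
      using * n base by (intro cross_param_less) auto
    moreover have "encloses {u, v} {x, y} \<longleftrightarrow> p u \<le> p x \<and> p y \<le> p v"
      using * encloses_iff[of u v x y] by auto
    ultimately show ?thesis using encloses_total[OF *(1,2,5,6,8,9)] by auto
  qed
  have sw: "cross_param n a b v u = cross_param n a b u v"
    if "u < n" "v < n" "b < n" "0 < p u" "p u < p b" "p b < p v" for u v
    using cross_param_pos(2)[of a n b u v] that base by simp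
  obtain u' v' where u: "{u, v} = {u', v'}" "u' < n" "v' < n" "b < n" "0 < p u'" "p u' < p b" "p b < p v'"
    using cross_baseE[OF assms(1,4)] by metis
  obtain x' y' where x: "{x, y} = {x', y'}" "x' < n" "y' < n" "0 < p x'" "p x' < p b" "p b < p y'"
    using cross_baseE[OF assms(2,5)] by metis
  have "cross_param n a b u v = cross_param n a b u' v'"
    using u sw by (metis doubleton_eq_iff)
  moreover have "cross_param n a b x y = cross_param n a b x' y'"
    using x u(4) sw by (metis doubleton_eq_iff)
  ultimately show ?thesis using main[of u' v' x' y'] assms u x by simp
qed

section \<open>Recursive description of T-paths from a fixed start\<close>

definition no_cross :: "nat \<Rightarrow> nat \<Rightarrow> bool" where
  "no_cross x y \<longleftrightarrow> (\<forall>e\<in>D. \<not> cross_diag n {x, y} e)"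

lemma no_cross_commute: "no_cross x y = no_cross y x"
  by (simp add: no_cross_def insert_commute)

text \<open>This is the endpoint-free part of being a \<open>T\<close>-path from \<open>a\<close>.
  With \<open>encloses\<close> in place of intersection parameters, every nonempty tail of a track
  is a track and can be continued to a different endpoint. \<open>paths\<close> adds the conditions
  that mention the endpoint.\<close>

fun track :: "nat list \<Rightarrow> bool" where
  "track [] \<longleftrightarrow> False"
| "track [x] \<longleftrightarrow> x = a"
| "track (y # x # q) \<longleftrightarrow> track (x # q) \<and> y < n \<and> y \<noteq> x \<and> {x, y} \<notin> steps (x # q) \<and> no_cross x y \<and>
    (odd (length q) \<longrightarrow> {x, y} \<in> D \<and> (\<forall>e\<in>odd_steps (x # q). encloses e {x, y}))"

text \<open>Each condition over all step indices splits into the earlier indices and the newest one,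
  and the latter is what one recursion step of \<open>track\<close> checks.\<close>

lemma track_rev_iff:
  "track r \<longleftrightarrow> r \<noteq> [] \<and> last r = a \<and> set r \<subseteq> {..<n} \<and>
     (\<forall>k < length r - 1. step (rev r) k \<in> diag n) \<and>
     distinct (map (step (rev r)) [0..<length r - 1]) \<and>
     (\<forall>k < length r - 1. \<forall>e\<in>D. \<not> cross_diag n (step (rev r) k) e) \<and>
     (\<forall>k < length r - 1. odd k \<longrightarrow> step (rev r) k \<in> D) \<and>
     (\<forall>k k'. k < k' \<and> k' < length r - 1 \<and> odd k \<and> odd k' \<longrightarrow>
        encloses (step (rev r) k) (step (rev r) k'))"
proof (induction r rule: track.induct)
  case 2
  then show ?case using base by auto
next
  case (3 y x q)
  let ?s = "step (rev q @ [x, y])" and ?t = "step (rev q @ [x])"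
  have st: "?s (length q) = {x, y}" and lt: "\<And>k. k < length q \<Longrightarrow> ?s k = ?t k"
    using step_append(1)[of _ "rev q"] step_append(2)[of "rev q"] by auto
  have mp: "map ?s [0..<length q] = map ?t [0..<length q]"
    by (rule map_cong) (auto simp: lt)
  have S: "steps (x # q) = ?t ` {k. k < length q}"
    and O: "odd_steps (x # q) = ?t ` {k. k < length q \<and> odd k}"
    using steps_rev[of "x # q"] odd_steps_rev[of "x # q"] by auto
  have all: "(\<forall>k < Suc (length q). P k) \<longleftrightarrow> (\<forall>k < length q. P k) \<and> P (length q)" for P
    by (auto simp: less_Suc_eq)
  have nest: "(\<forall>k k'. k < k' \<and> k' < Suc (length q) \<and> odd k \<and> odd k' \<longrightarrow> encloses (?s k) (?s k'))
    \<longleftrightarrow> (\<forall>k k'. k < k' \<and> k' < length q \<and> odd k \<and> odd k' \<longrightarrow> encloses (?t k) (?t k')) \<and>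
      (odd (length q) \<longrightarrow> (\<forall>e\<in>odd_steps (x # q). encloses e {x, y}))"
  proof -
    have "(\<forall>k k'. k < k' \<and> k' < Suc m \<and> odd k \<and> odd k' \<longrightarrow> P k k') \<longleftrightarrow>
      (\<forall>k k'. k < k' \<and> k' < m \<and> odd k \<and> odd k' \<longrightarrow> P k k') \<and> (odd m \<longrightarrow> (\<forall>k<m. odd k \<longrightarrow> P k m))"
      for m and P :: "nat \<Rightarrow> nat \<Rightarrow> bool"
      by (auto simp: less_Suc_eq)
    moreover have "(\<forall>k k'. k < k' \<and> k' < length q \<and> odd k \<and> odd k' \<longrightarrow> encloses (?s k) (?s k'))
      \<longleftrightarrow> (\<forall>k k'. k < k' \<and> k' < length q \<and> odd k \<and> odd k' \<longrightarrow> encloses (?t k) (?t k'))"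
      by (intro iff_allI imp_cong refl) (auto simp: lt)
    moreover have "(\<forall>k<length q. odd k \<longrightarrow> encloses (?s k) (?s (length q))) \<longleftrightarrow>
      (\<forall>e\<in>odd_steps (x # q). encloses e {x, y})"
      unfolding O using lt st by auto
    ultimately show ?thesis by simp
  qed
  have ds: "distinct (map ?s [0..<Suc (length q)]) \<longleftrightarrow>
      distinct (map ?t [0..<length q]) \<and> {x, y} \<notin> steps (x # q)"
    unfolding S by (auto simp: st mp)
  have q: "rev (y # x # q) = rev q @ [x, y]" "rev (x # q) = rev q @ [x]"
    "length (y # x # q) - 1 = Suc (length q)" "length (x # q) - 1 = length q" by auto
  have A: "(\<forall>k < Suc (length q). ?s k \<in> diag n) \<longleftrightarrow> (\<forall>k < length q. ?t k \<in> diag n) \<and> {x, y} \<in> diag n"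
    "(\<forall>k < Suc (length q). \<forall>e\<in>D. \<not> cross_diag n (?s k) e) \<longleftrightarrow>
      (\<forall>k < length q. \<forall>e\<in>D. \<not> cross_diag n (?t k) e) \<and> no_cross x y"
    "(\<forall>k < Suc (length q). odd k \<longrightarrow> ?s k \<in> D) \<longleftrightarrow>
      (\<forall>k < length q. odd k \<longrightarrow> ?t k \<in> D) \<and> (odd (length q) \<longrightarrow> {x, y} \<in> D)"
    unfolding all by (auto simp: lt st no_cross_def)
  have B: "set (y # x # q) \<subseteq> {..<n} \<longleftrightarrow> set (x # q) \<subseteq> {..<n} \<and> y < n"
    "last (y # x # q) = last (x # q)"
    by auto
  have C: "set (x # q) \<subseteq> {..<n} \<Longrightarrow> {x, y} \<in> diag n \<longleftrightarrow> y < n \<and> y \<noteq> x"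
    by (auto simp: diag_iff)
  show ?case
    unfolding track.simps(3) 3[unfolded q] q nest ds A B using C by blast
qed auto

definition paths :: "nat \<Rightarrow> nat list set" where
  "paths b = {r. track r \<and> 2 \<le> length r \<and> hd r = b \<and> (\<forall>e\<in>odd_steps r. cross_diag n e {a, b})}"

text \<open>The two descriptions differ essentially in the order condition. Odd-indexed steps are
  distinct diagonals of \<open>D\<close> crossing \<open>{a, b}\<close>, so
  \<open>cross_param_less_iff\<close> translates parameters into nesting.\<close>

lemma Tpaths_eq:
  assumes "b \<noteq> a"
  shows "Tpaths n D a b = rev ` paths b"
proof -
  have "is_Tpath n D a b (rev r) \<longleftrightarrow> r \<in> paths b" for r
  proof -
    have *: "(\<forall>k k'. k < k' \<and> k' < length r - 1 \<and> odd k \<and> odd k' \<longrightarrow>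
        cross_param n a b (rev r ! k) (rev r ! Suc k) < cross_param n a b (rev r ! k') (rev r ! Suc k'))
      \<longleftrightarrow> (\<forall>k k'. k < k' \<and> k' < length r - 1 \<and> odd k \<and> odd k' \<longrightarrow>
        encloses (step (rev r) k) (step (rev r) k'))"
      if d: "distinct (map (step (rev r)) [0..<length r - 1])"
        and o: "\<forall>k < length r - 1. odd k \<longrightarrow> step (rev r) k \<in> D \<and> cross_diag n (step (rev r) k) {a, b}"
    proof -
      have "cross_param n a b (rev r ! k) (rev r ! Suc k) < cross_param n a b (rev r ! k') (rev r ! Suc k')
        \<longleftrightarrow> encloses (step (rev r) k) (step (rev r) k')"
        if k: "k < k'" "k' < length r - 1" "odd k" "odd k'" for k k'
      proof -
        have "step (rev r) k \<noteq> step (rev r) k'"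
          using d k inj_onD[of "step (rev r)" "set [0..<length r - 1]" k k'] by (auto simp: distinct_map)
        moreover have "k < length r - 1" using k by simp
        ultimately show ?thesis
          using o k unfolding step_def by (intro cross_param_less_iff) auto
      qed
      then show ?thesis by blast
    qed
    have "(\<forall>k < length r - 1. odd k \<longrightarrow> step (rev r) k \<in> D \<and> cross_diag n (step (rev r) k) {a, b}) \<longleftrightarrow>
        (\<forall>k < length r - 1. odd k \<longrightarrow> step (rev r) k \<in> D) \<and> (\<forall>e\<in>odd_steps r. cross_diag n e {a, b})"
      unfolding odd_steps_rev by auto
    moreover have "2 \<le> length r \<Longrightarrow> r \<noteq> []" by auto
    ultimately show ?thesis
      unfolding is_Tpath_def paths_def mem_Collect_eq track_rev_iff hd_rev last_rev length_rev set_rev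
      using assms * by argo
  qed
  then have "is_Tpath n D a b ps \<longleftrightarrow> rev ps \<in> paths b" for ps
    by (metis rev_rev_ident)
  then show ?thesis
    unfolding Tpaths_def by (force intro: image_eqI[of _ _ "rev _"])
qed

text \<open>No step repeats, so the length counts the diagonals used; this bounds the paths for
  \<open>finite_paths\<close>.\<close>

lemma track_card_steps: "track r \<Longrightarrow> length r = Suc (card (steps r)) \<and> steps r \<subseteq> diag n \<and> set r \<subseteq> {..<n}"
proof (induction r rule: track.induct)
  case (3 y x q)
  then show ?case by (auto simp: finite_steps diag_iff)
qed (auto simp: base)

lemma finite_paths: "finite (paths b)"
proof -
  have "paths b \<subseteq> {r. set r \<subseteq> {..<n} \<and> length r \<le> Suc (card (diag n))}"
    using track_card_steps by (auto simp: paths_def card_mono finite_diag)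
  then show ?thesis by (rule finite_subset) (simp add: finite_lists_length_le)
qed

lemma odd_steps_in_D: "track r \<Longrightarrow> odd_steps r \<subseteq> D"
  by (induction r rule: track.induct) auto

text \<open>Odd and even indices alternate, so each vertex after \<open>a\<close> is an end of an
  odd-indexed step, except the head when the newest step has even index, that is, when the length is
  even.\<close>

lemma track_cover:
  "track r \<Longrightarrow> set (if even (length r) then tl r else r) \<subseteq> insert a (\<Union>(odd_steps r))"
proof (induction r rule: track.induct)
  case (3 y x q)
  then show ?case by (cases q) (auto split: if_splits)
qed auto

lemma not_in_crossing: "cross_diag n e {a, b} \<Longrightarrow> b \<notin> e"
  by (auto simp: cross_diag_def crosses_def doubleton_eq_iff)

text \<open>Otherwise the last step would be a diagonal with end \<open>b\<close> that crosses
  \<open>{a, b}\<close>.\<close>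

lemma paths_even:
  assumes "r \<in> paths b"
  shows "even (length r)"
proof (rule ccontr)
  assume odd: "odd (length r)"
  then obtain x q where r: "r = b # x # q"
    using assms by (cases r; cases "tl r") (auto simp: paths_def)
  then show False
    using assms odd not_in_crossing[of "{x, b}" b] by (auto simp: paths_def)
qed

text \<open>With nothing in \<open>D\<close> to cross there are no odd-indexed steps, and an even
  number of vertices then leaves a single step.\<close>

lemma paths_trivial:
  assumes "b < n" "b \<noteq> a" "\<And>e. e \<in> D \<Longrightarrow> \<not> cross_diag n e {a, b}"
  shows "paths b = {[b, a]}"
proof
  have "no_cross a b"
    using assms unfolding no_cross_def cross_diag_def by (metis crosses_swap(3))
  then show "{[b, a]} \<subseteq> paths b"
    using assms by (auto simp: paths_def)
  show "paths b \<subseteq> {[b, a]}"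
  proof
    fix r assume r: "r \<in> paths b"
    then have "odd_steps r = {}"
      using assms odd_steps_in_D by (fastforce simp: paths_def)
    moreover obtain x q where "r = b # x # q"
      using r by (cases r; cases "tl r") (auto simp: paths_def)
    ultimately show "r \<in> {[b, a]}"
      using r paths_even[OF r] by (cases q; cases "tl q") (auto simp: paths_def)
  qed
qed

end

section \<open>The diagonal closest to the endpoint\<close>

text \<open>In the first case \<open>x = d\<close> the new step along \<open>{c, d}\<close> cancels against the last step of the old path.\<close>

fun extend :: "nat \<Rightarrow> nat \<Rightarrow> nat list \<Rightarrow> nat list" where
  "extend d b (c # x # q) = (if x = d then b # x # q else b # d # c # x # q)"
| "extend d b q = q"

text \<open>\<open>{c, d}\<close> is the diagonal crossing \<open>{a, b}\<close> closest to
  \<open>b\<close>. Which of its ends comes first from \<open>a\<close> is left open, so that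
  \<open>swap\<close> carries every result for \<open>c\<close> over to \<open>d\<close>.\<close>

locale innermost = dissected_polygon +
  fixes b c d :: nat
  assumes cd: "{c, d} \<in> D" and crossing: "cross_diag n {c, d} {a, b}"
    and inner: "\<And>e. e \<in> D \<Longrightarrow> cross_diag n e {a, b} \<Longrightarrow> encloses e {c, d}"
begin

lemma swap: "innermost n D a b d c"
  using cd crossing inner by unfold_locales (simp_all add: insert_commute)

lemma less_n: "b < n" "c < n" "d < n"
  using crossing by (auto simp: cross_diag_iff crosses_p)

lemma distinct_abcd: "a \<noteq> b" "a \<noteq> c" "a \<noteq> d" "b \<noteq> c" "b \<noteq> d" "c \<noteq> d"
  using crossing by (auto simp: cross_diag_iff crosses_def)

lemma crossing_cases: "0 < p c \<and> p c < p b \<and> p b < p d \<or> 0 < p d \<and> p d < p b \<and> p b < p c"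
  using crossing crosses_base[of c d b] less_n by (simp add: cross_diag_iff)

lemma no_cross_cd: "no_cross c d"
  using cd D_no_cross by (auto simp: no_cross_def)

text \<open>A diagonal separating \<open>c\<close> from \<open>a\<close> cannot cross
  \<open>{c, d}\<close>, hence has \<open>d\<close> weakly on the side of \<open>c\<close>; then
  \<open>b\<close>, lying between \<open>c\<close> and \<open>d\<close> in position, is separated
  from \<open>a\<close> as well.\<close>

lemma crossing_side:
  assumes "e \<in> D" "cross_diag n e {a, c}"
  shows "cross_diag n e {a, b}" "encloses e {c, d}"
proof -
  obtain u v where e: "e = {u, v}" "u < n" "v < n" "0 < p u" "p u < p c" "p c < p v"
    using cross_baseE[OF assms] by metis
  have "\<not> interlace (p u) (p v) (p c) (p d)"
    using D_no_cross[OF assms(1) cd] e less_n by (simp add: cross_diag_iff crosses_p)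
  then have d: "p u \<le> p d" "p d \<le> p v"
    using e p_eq[of c d] less_n distinct_abcd by (auto simp: interlace_def between_def)
  have "p u < p b" "p b < p v"
    using d e crossing_cases by linarith+
  then show "cross_diag n e {a, b}"
    using e less_n by (auto intro!: cross_baseI)
  show "encloses e {c, d}"
    unfolding e(1) using e d by (simp add: encloses_iff)
qed

text \<open>Enclosing \<open>{c, d}\<close> puts \<open>c\<close> weakly between the ends of
  \<open>e\<close>, and strictly so because \<open>c\<close> is not an end.\<close>

lemma crossing_sideI:
  assumes "e \<in> D" "cross_diag n e {a, b}" "c \<notin> e"
  shows "cross_diag n e {a, c}"
proof -
  obtain u v where e: "e = {u, v}" "u < n" "v < n" "0 < p u" "p u < p b" "p b < p v"
    using cross_baseE[OF assms(1,2)] by metis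
  then have "p u \<le> p c" "p c \<le> p v"
    using inner[OF assms(1,2)] by (simp_all add: encloses_iff)
  moreover have "p u \<noteq> p c" "p c \<noteq> p v" using e assms(3) p_eq less_n by auto
  ultimately show ?thesis
    unfolding e(1) using e less_n by (intro cross_baseI) auto
qed

text \<open>Crossing \<open>{a, c}\<close> passes outwards along the nesting; thus it suffices to
  check the latest odd-indexed step of a path.\<close>

lemma crossing_side_mono:
  assumes "e \<in> D" "e' \<in> D" "cross_diag n e {a, b}" "cross_diag n e' {a, c}" "encloses e e'"
  shows "cross_diag n e {a, c}"
proof -
  obtain u v where e: "e = {u, v}" "u < n" "v < n" "0 < p u" "p u < p b" "p b < p v"
    using cross_baseE[OF assms(1,3)] by metis
  obtain x y where e': "e' = {x, y}" "x < n" "y < n" "0 < p x" "p x < p c" "p c < p y"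
    using cross_baseE[OF assms(2,4)] by metis
  have "p u \<le> p x" "p y \<le> p v"
    using assms(5) e e' by (simp_all add: encloses_iff)
  then show ?thesis
    unfolding e(1) using e e' less_n by (intro cross_baseI) auto
qed

text \<open>A diagonal of \<open>D\<close> crossing \<open>{d, b}\<close> has one end strictly
  between \<open>d\<close> and \<open>b\<close>. As it does not cross \<open>{c, d}\<close>, its
  other end lies beyond \<open>b\<close>, at \<open>c\<close> or before it. It would then cross
  \<open>{a, b}\<close> without enclosing \<open>d\<close>, contradicting
  \<open>inner\<close>.\<close>

lemma no_cross_db: "no_cross d b"
  unfolding no_cross_def
proof (intro ballI notI)
  fix e assume e: "e \<in> D" "cross_diag n {d, b} e"
  obtain u v where uv: "e = {u, v}" "u < n" "v < n"
    and u: "between (p d) (p b) (p u)" and v: "\<not> between (p d) (p b) (p v)"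
    and dist: "p v \<noteq> p d" "p v \<noteq> p b"
  proof -
    obtain u v where uv: "e = {u, v}" "u < n" "v < n"
      using e(1) D_diag by (auto simp: diag_def)
    then have "interlace (p d) (p b) (p u) (p v)"
      using e by (simp add: cross_diag_iff crosses_p)
    then show ?thesis
      using that[of u v] that[of v u] uv by (auto simp: interlace_def insert_commute)
  qed
  have "\<not> interlace (p c) (p d) (p u) (p v)"
    using D_no_cross[OF cd e(1)] uv less_n by (simp add: cross_diag_iff crosses_p)
  moreover have "between (p c) (p d) (p u)"
    using u crossing_cases by (auto simp: between_def)
  ultimately have "p v = p c \<or> between (p c) (p d) (p v)"
    using u v dist by (auto simp: interlace_def between_def)
  then have *: "0 < p v \<and> p v < p b \<and> p b < p u \<and> p u < p d \<or> p d < p u \<and> 0 < p u \<and> p u < p b \<and> p b < p v"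
    using crossing_cases u v dist unfolding between_def by linarith
  then have "encloses e {c, d}"
    using inner[OF e(1)] uv less_n crosses_base[of u v b] by (auto simp: cross_diag_iff)
  then show False
    using * uv(1) encloses_iff[of u v c d] encloses_iff[of v u c d]
    by (auto simp: insert_commute[of v u])
qed

text \<open>Before the final \<open>c\<close>, a path visits only \<open>a\<close> and ends of
  diagonals that cross both \<open>{a, c}\<close> and \<open>{a, b}\<close>. So \<open>c\<close> and
  \<open>b\<close> do not occur there, and the new steps repeat no old one. By
  \<open>crossing_side\<close> the old odd-indexed steps all enclose the new one,
  \<open>{c, d}\<close>.\<close>

lemma extend_in_paths:
  assumes r: "r \<in> paths c"
  shows "extend d b r \<in> paths b"
proof -
  obtain x q where rq: "r = c # x # q"
    using r by (cases r; cases "tl r") (auto simp: paths_def)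
  have ev: "even (length q)" using paths_even[OF r] rq by simp
  have tr: "track (c # x # q)" and cr: "\<And>e. e \<in> odd_steps r \<Longrightarrow> cross_diag n e {a, c}"
    using r rq by (auto simp: paths_def)
  have D: "odd_steps r \<subseteq> D" using odd_steps_in_D tr rq by blast
  have cr': "cross_diag n e {a, b}" "encloses e {c, d}" if "e \<in> odd_steps r" for e
    using crossing_side[of e] cr D that by blast+
  have "set (x # q) \<subseteq> insert a (\<Union>(odd_steps r))"
    using track_cover[OF tr] ev rq by simp
  moreover have "c \<notin> \<Union>(odd_steps r)" "b \<notin> \<Union>(odd_steps r)"
    using cr cr'(1) not_in_crossing by blast+
  ultimately have notin: "c \<notin> set (x # q)" "b \<notin> set (x # q)"
    using distinct_abcd by auto
  show ?thesis
  proof (cases "x = d")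
    case True
    have "{d, b} \<notin> steps (x # q)"
      using steps_subset_set[of "{d, b}" "x # q"] notin by auto
    then show ?thesis
      using True tr ev cr'(1) rq less_n distinct_abcd no_cross_db by (auto simp: paths_def)
  next
    case False
    have "{c, d} \<notin> steps (x # q)" "{d, b} \<notin> steps (x # q)"
      using steps_subset_set[of _ "x # q"] notin by blast+
    then have 1: "{c, d} \<notin> steps (c # x # q)" "{d, b} \<notin> steps (d # c # x # q)"
      using False notin distinct_abcd by (auto simp: doubleton_eq_iff)
    have t: "track (d # c # x # q)"
      using tr less_n distinct_abcd 1 no_cross_cd cd cr'(2) rq ev by (simp del: steps.simps odd_steps.simps)
    have "track (b # d # c # x # q)"
      using t less_n distinct_abcd 1 no_cross_db ev
      by (subst track.simps) (simp del: steps.simps odd_steps.simps track.simps)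
    moreover have "odd_steps (b # d # c # x # q) = insert {c, d} (odd_steps r)"
      using ev rq by simp
    ultimately show ?thesis
      using False cr'(1) crossing rq by (auto simp: paths_def simp del: track.simps odd_steps.simps)
  qed
qed

text \<open>The penultimate vertex tells the two families in \<open>paths_eq\<close> apart.\<close>

lemma hd_tl_extend: "r \<in> paths c \<Longrightarrow> hd (tl (extend d b r)) = d"
  by (cases r; cases "tl r") (auto simp: paths_def)

text \<open>If a contracted and an uncontracted extension agreed, the contracted path would have
  started as \<open>c # d # c # _\<close>, which uses \<open>{c, d}\<close> twice.\<close>

lemma inj_extend: "inj_on (extend d b) (paths c)"
proof (rule inj_onI)
  fix r s assume rs: "r \<in> paths c" "s \<in> paths c" "extend d b r = extend d b s"
  obtain x q where r: "r = c # x # q"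
    using rs by (cases r; cases "tl r") (auto simp: paths_def)
  obtain y t where s: "s = c # y # t"
    using rs by (cases s; cases "tl s") (auto simp: paths_def)
  have "{d, c} \<notin> steps (x # q)" if "x = d" using rs r that by (auto simp: paths_def)
  moreover have "{d, c} \<notin> steps (y # t)" if "y = d" using rs s that by (auto simp: paths_def)
  ultimately show "r = s"
    using rs(3) unfolding r s by (auto split: if_splits simp: insert_commute)
qed

text \<open>A preimage under \<open>extend\<close> is found by undoing it: if \<open>c\<close>
  precedes \<open>d\<close>, drop \<open>b\<close> and \<open>d\<close>; otherwise replace
  \<open>b\<close> by \<open>c\<close>, so that \<open>extend\<close> contracts the
  backtrack.\<close>

lemma paths_shorten:
  assumes r: "b # d # x # q \<in> paths b"
  shows "b # d # x # q \<in> extend d b ` paths c"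
proof -
  have ev: "odd (length q)" using paths_even[OF r] by simp
  have t: "track (d # x # q)" "track (x # q)" and xd: "{x, d} \<in> D" "{x, d} \<notin> steps (x # q)" "x \<noteq> d"
    and enc: "\<And>e. e \<in> odd_steps (x # q) \<Longrightarrow> encloses e {x, d}"
    and cr: "\<And>e. e \<in> odd_steps (d # x # q) \<Longrightarrow> cross_diag n e {a, b}"
    using r ev by (auto simp: paths_def)
  have D: "odd_steps (d # x # q) \<subseteq> D" using odd_steps_in_D[OF t(1)] .
  have os: "odd_steps (d # x # q) = insert {x, d} (odd_steps (x # q))"
    using ev by simp
  show ?thesis
  proof (cases "x = c")
    case True
    obtain w q' where q: "q = w # q'" using ev by (cases q) auto
    \<comment> \<open>\<open>w = d\<close> would repeat \<open>{c, d}\<close>; hence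
      \<open>extend\<close> takes its second branch below.\<close>
    have w: "w \<noteq> d" "w \<noteq> c" using xd t(2) True q by auto
    have cr': "cross_diag n e {a, c}" if e: "e \<in> odd_steps (x # q)" for e
    proof (cases q')
      case Nil
      then show ?thesis using e q by simp
    next
      case (Cons v s)
      have ev': "odd (length s)" using ev q Cons by simp
      have tw: "track (w # v # s)" and "{w, c} \<notin> steps (w # v # s)" using t(2) q Cons True by auto
      \<comment> \<open>\<open>v = c\<close> would repeat the step \<open>{w, c}\<close>.\<close>
      then have vw: "c \<notin> {v, w}" using w by auto
      have eo: "e \<in> insert {v, w} (odd_steps (v # s))" "{v, w} \<in> odd_steps (x # q)"
        using e ev' q Cons by auto
      have "{v, w} \<in> D" "cross_diag n {v, w} {a, b}" using eo D os cr by auto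
      then have cvw: "cross_diag n {v, w} {a, c}" using crossing_sideI vw by blast
      have "e = {v, w} \<or> encloses e {v, w}" using eo tw ev' by auto
      then show ?thesis
        using crossing_side_mono[of e "{v, w}"] cvw e os cr D \<open>{v, w} \<in> D\<close> by auto
    qed
    then have "c # q \<in> paths c"
      using t(2) True q by (auto simp: paths_def)
    moreover have "extend d b (c # q) = b # d # x # q" using True w q by simp
    ultimately show ?thesis by (metis image_eqI)
  next
    case False
    have cxd: "cross_diag n {x, d} {a, c}"
      using crossing_sideI[OF xd(1)] cr os False distinct_abcd by auto
    have cr': "cross_diag n e {a, c}" if e: "e \<in> odd_steps (d # x # q)" for e
    proof -
      have "e = {x, d} \<or> e \<in> odd_steps (x # q)" using e unfolding os by (rule insertE) simp_all
      then show ?thesis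
        using crossing_side_mono[OF subsetD[OF D e] xd(1) cr[OF e] cxd] enc cxd by metis
    qed
    have "set (d # x # q) \<subseteq> insert a (\<Union>(odd_steps (d # x # q)))"
      using track_cover[OF t(1)] ev by simp
    moreover have "c \<notin> \<Union>(odd_steps (d # x # q))"
      using cr' not_in_crossing by blast
    ultimately have "c \<notin> set (d # x # q)"
      using distinct_abcd by (metis (no_types, lifting) insert_iff subsetD)
    then have "{d, c} \<notin> steps (d # x # q)"
      using steps_subset_set[of "{d, c}" "d # x # q"] by auto
    then have "track (c # d # x # q)"
      using t(1) ev less_n distinct_abcd no_cross_cd no_cross_commute[of c d]
      by (subst track.simps) (simp del: steps.simps odd_steps.simps track.simps)
    moreover have "odd_steps (c # d # x # q) = odd_steps (d # x # q)"
      using ev by simp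
    ultimately have "c # d # x # q \<in> paths c"
      using cr' by (auto simp: paths_def simp del: track.simps odd_steps.simps)
    moreover have "extend d b (c # d # x # q) = b # d # x # q" by simp
    ultimately show ?thesis by (metis image_eqI)
  qed
qed

text \<open>The vertex \<open>y\<close> before \<open>b\<close> is not \<open>a\<close>, since
  \<open>{a, b}\<close> crosses \<open>{c, d}\<close>. So it is an end of a diagonal enclosing
  \<open>{c, d}\<close>, and the step from \<open>y\<close> to \<open>b\<close> avoids crossing
  \<open>{c, d}\<close> only if \<open>y\<close> is \<open>c\<close> or \<open>d\<close>.\<close>

lemma paths_penultimate:
  assumes r: "r \<in> paths b"
  obtains y x q where "r = b # y # x # q" "y = c \<or> y = d"
proof -
  obtain y s where s: "r = b # y # s"
    using r by (cases r; cases "tl r") (auto simp: paths_def)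
  have nc: "no_cross y b" and t: "track (y # s)" using r s by (auto simp: paths_def)
  have ev: "even (length s)" using paths_even[OF r] s by simp
  obtain x q where q: "s = x # q"
  proof (cases s)
    case Nil
    then have "y = a" using t by simp
    then have False
      using nc cd crossing by (auto simp: no_cross_def cross_diag_iff crosses_swap)
    then show ?thesis ..
  qed
  have xy: "{x, y} \<in> D" "cross_diag n {x, y} {a, b}" using r s q ev by (auto simp: paths_def)
  obtain u v where e: "{x, y} = {u, v}" "u < n" "v < n" "0 < p u" "p u < p b" "p b < p v"
    using cross_baseE[OF xy] by metis
  have encl: "p u \<le> p c" "p u \<le> p d" "p c \<le> p v" "p d \<le> p v"
    using inner[OF xy] e by (simp_all add: encloses_iff)
  have y: "y = u \<or> y = v" "y < n" using e by (auto simp: doubleton_eq_iff)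
  have "\<not> interlace (p y) (p b) (p c) (p d)"
    using nc cd y less_n by (auto simp: no_cross_def cross_diag_iff crosses_p)
  then have "p y = p c \<or> p y = p d"
    using y(1) encl e crossing_cases by (auto simp: interlace_def between_def)
  then have "y = c \<or> y = d" using p_eq y less_n by blast
  then show ?thesis using that s q by blast
qed

lemma paths_eq: "paths b = extend d b ` paths c \<union> extend c b ` paths d"
proof
  interpret s: innermost n D a b d c by (rule swap)
  show "paths b \<subseteq> extend d b ` paths c \<union> extend c b ` paths d"
    using paths_penultimate paths_shorten s.paths_shorten by (metis UnI1 UnI2 subsetI)
  show "extend d b ` paths c \<union> extend c b ` paths d \<subseteq> paths b"
    using extend_in_paths s.extend_in_paths by auto
qed

text \<open>Appending multiplies by \<open>f {d, b}\<close> and divides by \<open>f {c, d}\<close>.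
  Contracting instead replaces the final factor \<open>f {d, c}\<close> by \<open>f {d, b}\<close>,
  which has the same effect.\<close>

lemma weight_extend:
  assumes "r \<in> paths c"
  shows "weight f (extend d b r) * f {c, d} = weight f r * f {d, b}"
proof -
  obtain x q where r: "r = c # x # q"
    using assms by (cases r; cases "tl r") (auto simp: paths_def)
  have "even (length q)" using paths_even[OF assms] r by simp
  then show ?thesis
    unfolding r by (auto simp: ac_simps insert_commute)
      (metis mult.assoc mult.commute psf_divide_mult)
qed

lemma ssum_extend:
  assumes "paths c \<noteq> {}"
  shows "ssum (weight f) (extend d b ` paths c) * f {c, d} = ssum (weight f) (paths c) * f {d, b}"
proof -
  have "ssum (weight f) (extend d b ` paths c) * f {c, d}
      = ssum (\<lambda>r. weight f (extend d b r) * f {c, d}) (paths c)"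
    using assms by (simp add: ssum_image finite_paths inj_extend ssum_mult_right)
  also have "\<dots> = ssum (\<lambda>r. weight f r * f {d, b}) (paths c)"
    using assms by (intro ssum_cong) (auto simp: finite_paths weight_extend)
  finally show ?thesis using assms by (simp add: ssum_mult_right finite_paths)
qed

lemma ssum_paths:
  assumes "paths c \<noteq> {}" "paths d \<noteq> {}"
  shows "ssum (weight f) (paths b) * f {c, d} =
    ssum (weight f) (paths c) * f {d, b} + ssum (weight f) (paths d) * f {c, b}"
proof -
  interpret s: innermost n D a b d c by (rule swap)
  have "extend d b ` paths c \<inter> extend c b ` paths d = {}"
    using hd_tl_extend s.hd_tl_extend distinct_abcd by fastforce
  then show ?thesis
    using assms ssum_extend[of f] s.ssum_extend[of f]
    by (simp add: paths_eq ssum_union finite_paths distrib_right insert_commute)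
qed

end

section \<open>Weak friezes and the T-path formula\<close>

context dissected_polygon
begin

text \<open>Among the diagonals straddling \<open>b\<close>, take one of least width
  \<open>p d - p c\<close>; since any two are nested, all others enclose it.\<close>

lemma innermost_exists:
  assumes "e0 \<in> D" "cross_diag n e0 {a, b}"
  obtains c d where "innermost n D a b c d" "p c < p b" "p b < p d"
proof -
  define M where "M = (\<lambda>(u, v). {u, v} \<in> D \<and> u < n \<and> v < n \<and> b < n \<and> 0 < p u \<and> p u < p b \<and> p b < p v)"
  obtain u v where "e0 = {u, v}" "u < n" "v < n" "b < n" "0 < p u" "p u < p b" "p b < p v"
    using cross_baseE[OF assms] by metis
  then have "M (u, v)" using assms(1) by (simp add: M_def)
  then obtain m where m: "M m" "\<And>m'. M m' \<Longrightarrow> p (snd m) - p (fst m) \<le> p (snd m') - p (fst m')"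
    using ex_has_least_nat[of M _ "\<lambda>m. p (snd m) - p (fst m)"] by blast
  obtain c d where cd: "m = (c, d)" by (cases m)
  have M: "{c, d} \<in> D" "c < n" "d < n" "b < n" "0 < p c" "p c < p b" "p b < p d"
    using m(1) cd by (auto simp: M_def)
  have "encloses e {c, d}" if e: "e \<in> D" "cross_diag n e {a, b}" for e
  proof -
    obtain x y where xy: "e = {x, y}" "x < n" "y < n" "0 < p x" "p x < p b" "p b < p y"
      using cross_baseE[OF e] by metis
    then have "p d - p c \<le> p y - p x"
      using m(2)[of "(x, y)"] M e by (auto simp: M_def cd)
    moreover have "p x \<le> p c \<and> p d \<le> p y \<or> p c \<le> p x \<and> p y \<le> p d"
      using encloses_total[of x y c d "p b"] e xy M by simp
    ultimately have "p x \<le> p c \<and> p d \<le> p y" using xy M by linarith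
    then show ?thesis using xy M by (simp add: encloses_iff)
  qed
  then have "innermost n D a b c d"
    using M by unfold_locales (auto intro: cross_baseI)
  then show ?thesis using that M by blast
qed

definition crossings :: "nat \<Rightarrow> nat" where
  "crossings b = card {e \<in> D. cross_diag n e {a, b}}"

text \<open>Diagonals crossing \<open>{a, c}\<close> also cross \<open>{a, b}\<close>, while
  \<open>{c, d}\<close> itself crosses only the latter. This drives all the inductions
  below.\<close>

lemma crossings_less:
  assumes "{c, d} \<in> D" "cross_diag n {c, d} {a, b}"
  shows "crossings c < crossings b"
proof -
  have n: "c < n" "d < n" "b < n" using assms(2) by (auto simp: cross_diag_iff crosses_p)
  have cd: "0 < p c \<and> p c < p b \<and> p b < p d \<or> 0 < p d \<and> p d < p b \<and> p b < p c"
    using assms(2) crosses_base[of c d b] n by (simp add: cross_diag_iff)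
  have "cross_diag n e {a, b}" if e: "e \<in> D" "cross_diag n e {a, c}" for e
  proof -
    obtain u v where uv: "e = {u, v}" "u < n" "v < n" "0 < p u" "p u < p c" "p c < p v"
      using cross_baseE[OF e] by metis
    have "\<not> interlace (p u) (p v) (p c) (p d)"
      using D_no_cross[OF e(1) assms(1)] uv n by (simp add: cross_diag_iff crosses_p)
    then have "p u < p b" "p b < p v"
      using uv cd by (auto simp: interlace_def between_def)
    then show ?thesis using uv n by (auto intro!: cross_baseI)
  qed
  moreover have "\<not> cross_diag n {c, d} {a, c}" by (simp add: cross_diag_iff crosses_def)
  ultimately have "{e \<in> D. cross_diag n e {a, c}} \<subset> {e \<in> D. cross_diag n e {a, b}}"
    using assms by auto
  moreover have "finite D" using D_diag finite_diag finite_subset by blast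
  ultimately show ?thesis unfolding crossings_def by (intro psubset_card_mono) auto
qed

text \<open>Additive semigroups have no empty sum, so splitting and evaluating \<open>ssum\<close>
  requires a path to exist; \<open>extend\<close> supplies one inductively.\<close>

lemma paths_nonempty: "b < n \<Longrightarrow> b \<noteq> a \<Longrightarrow> paths b \<noteq> {}"
proof (induction "crossings b" arbitrary: b rule: less_induct)
  case less
  show ?case
  proof (cases "\<exists>e\<in>D. cross_diag n e {a, b}")
    case True
    then obtain c d where "innermost n D a b c d" using innermost_exists by blast
    then interpret i: innermost n D a b c d .
    have "paths c \<noteq> {}"
      using less.hyps[of c] crossings_less[OF i.cd i.crossing] i.less_n i.distinct_abcd by auto
    then show ?thesis using i.extend_in_paths by blast
  qed (use less.prems paths_trivial[of b] in auto)
qed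

lemma ssum_Tpaths:
  assumes "b < n" "b \<noteq> a"
  shows "ssum (fpath f) (Tpaths n D a b) = ssum (weight f) (paths b)"
  using assms by (simp add: Tpaths_eq ssum_image finite_paths paths_nonempty inj_on_def fpath_rev)

lemma ssum_trivial:
  assumes "b < n" "b \<noteq> a" "\<And>e. e \<in> D \<Longrightarrow> \<not> cross_diag n e {a, b}"
  shows "ssum (fpath f) (Tpaths n D a b) = f {a, b}"
  using assms by (simp add: ssum_Tpaths paths_trivial ssum_singleton)

end

lemma (in innermost) ssum_Tpaths_ptolemy:
  "ssum (fpath f) (Tpaths n D a b) * f {c, d} =
    ssum (fpath f) (Tpaths n D a c) * f {b, d} + ssum (fpath f) (Tpaths n D a d) * f {b, c}"
  using ssum_paths[of f] less_n distinct_abcd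
  by (simp add: ssum_Tpaths paths_nonempty insert_commute)

lemma weak_frieze_Tpath_formula:
  assumes dis: "dissection n D" and f: "weak_frieze n D f" and "a < n" "b < n" "a \<noteq> b"
  shows "f {a, b} = ssum (fpath f) (Tpaths n D a b)"
proof -
  interpret dissected_polygon n D a using assms by unfold_locales
  show ?thesis
    using assms(4,5)
  proof (induction "crossings b" arbitrary: b rule: less_induct)
    case less
    show ?case
    proof (cases "\<exists>e\<in>D. cross_diag n e {a, b}")
      case True
      then obtain c d where i: "innermost n D a b c d" using innermost_exists by blast
      then interpret i: innermost n D a b c d .
      interpret s: innermost n D a b d c by (rule i.swap)
      have "crosses n a b c d" using i.crossing by (simp add: cross_diag_iff crosses_swap)
      then have "f {a, b} * f {c, d} = f {a, c} * f {b, d} + f {a, d} * f {b, c}"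
        using f i.cd unfolding weak_frieze_def by blast
      \<comment> \<open>The induction hypothesis turns both terms into sums, which then
        recombine.\<close>
      also have "\<dots> = ssum (fpath f) (Tpaths n D a b) * f {c, d}"
        unfolding i.ssum_Tpaths_ptolemy
        using less.hyps[of c] less.hyps[of d] crossings_less[OF i.cd i.crossing]
          crossings_less[OF s.cd s.crossing] i.less_n i.distinct_abcd by simp
      finally show ?thesis by (simp only: psf_cancel)
    qed (use less.prems ssum_trivial[of b f] in auto)
  qed
qed

section \<open>Gluing Ptolemy relations\<close>

definition ptolemy :: "(nat set \<Rightarrow> 'k::psemifield) \<Rightarrow> nat \<Rightarrow> nat \<Rightarrow> nat \<Rightarrow> nat \<Rightarrow> bool" where
  "ptolemy f a b c d \<longleftrightarrow> f {a, b} * f {c, d} = f {a, c} * f {b, d} + f {a, d} * f {b, c}"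

lemma ptolemy_swap:
  "ptolemy f a b d c = ptolemy f a b c d" "ptolemy f b a c d = ptolemy f a b c d"
  by (simp_all add: ptolemy_def insert_commute add.commute mult.commute)

text \<open>Multiply by \<open>f {u, v}\<close>, expand \<open>{a, b}\<close> along
  \<open>{u, v}\<close> and then \<open>{a, u}\<close>, \<open>{a, v}\<close> along
  \<open>{c, d}\<close>. The terms regroup into the expansions of \<open>{d, b}\<close> and
  \<open>{c, b}\<close> along \<open>{u, v}\<close>, and \<open>f {u, v}\<close> cancels.\<close>

lemma ptolemy_glue:
  assumes "ptolemy f a b u v" "ptolemy f a u c d" "ptolemy f a v c d"
    and "ptolemy f d b u v" "ptolemy f c b u v"
  shows "ptolemy f a b c d"
proof -
  have "f {a, b} * f {c, d} * f {u, v} = (f {a, c} * f {b, d} + f {a, d} * f {b, c}) * f {u, v}"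
  proof -
    have "f {a, b} * f {c, d} * f {u, v} = (f {a, b} * f {u, v}) * f {c, d}" by (simp only: ac_simps)
    also have "\<dots> = (f {a, u} * f {c, d}) * f {b, v} + (f {a, v} * f {c, d}) * f {b, u}"
      using assms(1) by (simp add: ptolemy_def algebra_simps)
    also have "\<dots> = (f {a, c} * f {u, d} + f {a, d} * f {u, c}) * f {b, v}
        + (f {a, c} * f {v, d} + f {a, d} * f {v, c}) * f {b, u}"
      using assms(2,3) by (simp add: ptolemy_def)
    also have "\<dots> = f {a, c} * (f {d, u} * f {b, v} + f {d, v} * f {b, u})
        + f {a, d} * (f {c, u} * f {b, v} + f {c, v} * f {b, u})"
      by (simp add: algebra_simps insert_commute)
    also have "\<dots> = f {a, c} * (f {d, b} * f {u, v}) + f {a, d} * (f {c, b} * f {u, v})"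
      using assms(4,5) by (simp add: ptolemy_def)
    also have "\<dots> = (f {a, c} * f {b, d} + f {a, d} * f {b, c}) * f {u, v}"
      by (simp add: algebra_simps insert_commute)
    finally show ?thesis .
  qed
  then show ?thesis by (simp add: ptolemy_def psf_cancel)
qed

text \<open>This is the degenerate case \<open>u = c\<close>, where two relations of
  \<open>ptolemy_glue\<close> would involve \<open>{c, c}\<close>, which is not a diagonal. The same
  regrouping works with the remaining three.\<close>

lemma ptolemy_glue_shared:
  assumes "ptolemy f a b c v" "ptolemy f a v c d" "ptolemy f d b c v"
  shows "ptolemy f a b c d"
proof -
  have "f {a, b} * f {c, d} * f {c, v} = (f {a, c} * f {b, d} + f {a, d} * f {b, c}) * f {c, v}"
  proof -
    have "f {a, b} * f {c, d} * f {c, v} = (f {a, b} * f {c, v}) * f {c, d}" by (simp only: ac_simps)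
    also have "\<dots> = f {a, c} * f {b, v} * f {c, d} + (f {a, v} * f {c, d}) * f {b, c}"
      using assms(1) by (simp add: ptolemy_def algebra_simps)
    also have "\<dots> = f {a, c} * f {b, v} * f {c, d} + (f {a, c} * f {v, d} + f {a, d} * f {v, c}) * f {b, c}"
      using assms(2) by (simp add: ptolemy_def)
    also have "\<dots> = f {a, c} * (f {d, c} * f {b, v} + f {d, v} * f {b, c}) + f {a, d} * f {b, c} * f {c, v}"
      by (simp add: algebra_simps insert_commute)
    also have "\<dots> = f {a, c} * (f {d, b} * f {c, v}) + f {a, d} * f {b, c} * f {c, v}"
      using assms(3) by (simp add: ptolemy_def)
    also have "\<dots> = (f {a, c} * f {b, d} + f {a, d} * f {b, c}) * f {c, v}"
      by (simp add: algebra_simps insert_commute)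
    finally show ?thesis .
  qed
  then show ?thesis by (simp add: ptolemy_def psf_cancel)
qed

lemma Tpath_formula_ptolemy:
  fixes f :: "nat set \<Rightarrow> 'k::psemifield"
  assumes dis: "dissection n D"
    and f: "\<And>a b. a < n \<Longrightarrow> b < n \<Longrightarrow> a \<noteq> b \<Longrightarrow> f {a, b} = ssum (fpath f) (Tpaths n D a b)"
    and "crosses n a b c d" "{c, d} \<in> D"
  shows "ptolemy f a b c d"
  using assms(3,4)
proof (induction "card {e \<in> D. cross_diag n e {a, b}}" arbitrary: a b c d rule: less_induct)
  case less
  interpret dissected_polygon n D a
    using less.prems dis by unfold_locales (auto simp: crosses_def)
  \<comment> \<open>The gluing also uses diagonals ending at \<open>b\<close>; their crossings are
    counted from \<open>b\<close> as base.\<close>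
  interpret B: dissected_polygon n D b
    using less.prems dis by unfold_locales (auto simp: crosses_def)
  obtain u v where "innermost n D a b u v" and uv: "p u < p b" "p b < p v"
    using innermost_exists[of "{c, d}" b] less.prems crosses_swap(3)[of n c d a b]
    by (metis cross_diag_iff)
  then interpret i: innermost n D a b u v by simp
  \<comment> \<open>For the closest diagonal this is the relation between path sums, with each sum
    replaced by the value of \<open>f\<close>.\<close>
  have "ptolemy f a b u v"
    using i.ssum_Tpaths_ptolemy[of f] i.less_n i.distinct_abcd base
    by (simp add: ptolemy_def f[symmetric])
  have main: "ptolemy f a b c d" if cd: "crosses n a b c d" "{c, d} \<in> D" "p c < p b" "p b < p d" for c d
  proof -
    have c: "cross_diag n {c, d} {a, b}" "cross_diag n {d, c} {b, a}" "cross_diag n {c, d} {b, a}"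
      and n: "c < n" "d < n"
      using cd by (auto simp: cross_diag_iff crosses_swap crosses_p)
    have A: "ptolemy f a z c d" if "crosses n a z c d" "z = u \<or> z = v" for z
      using less.hyps[of a z c d] crossings_less[OF i.cd i.crossing] crossings_less[of v u b]
        i.cd i.crossing that cd by (auto simp: crossings_def insert_commute)
    \<comment> \<open>Seen from \<open>b\<close>, both \<open>{b, c}\<close> and
      \<open>{b, d}\<close> are crossed by fewer diagonals than \<open>{b, a}\<close>.\<close>
    have C: "ptolemy f z b u v" if "crosses n z b u v" "z = c \<or> z = d" for z
      using less.hyps[of z b u v] B.crossings_less[of c d a] B.crossings_less[of d c a]
        c cd i.cd that by (auto simp: B.crossings_def insert_commute)
    \<comment> \<open>\<open>{c, d}\<close> encloses \<open>{u, v}\<close>; so all crossings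
      required for gluing hold unless ends coincide, which the case split handles.\<close>
    have "p c \<le> p u" "p v \<le> p d"
      using i.inner[OF cd(2) c(1)] cd encloses_iff[of c d u v] by auto
    moreover have "0 < p c"
      using cd crosses_base[of c d b] i.less_n n by (auto simp: crosses_swap)
    ultimately have cr: "u \<noteq> c \<Longrightarrow> crosses n a u c d" "v \<noteq> d \<Longrightarrow> crosses n a v c d"
      "u \<noteq> c \<Longrightarrow> crosses n c b u v" "v \<noteq> d \<Longrightarrow> crosses n d b u v"
      using uv n i.less_n base p_eq[of u c] p_eq[of v d]
      by (auto simp: crosses_p p_base interlace_def between_def)
    show ?thesis
    proof (cases "u = c"; cases "v = d")
      assume "u = c" "v = d"
      then show ?thesis using \<open>ptolemy f a b u v\<close> by simp
    next
      assume "u = c" "v \<noteq> d"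
      then show ?thesis
        using \<open>ptolemy f a b u v\<close> ptolemy_glue_shared A C cr by metis
    next
      assume "u \<noteq> c" "v = d"
      then have "ptolemy f a b d c"
        using \<open>ptolemy f a b u v\<close> ptolemy_glue_shared[of f a b d u c] A[of u] C[of c] cr
        by (simp add: ptolemy_swap)
      then show ?thesis by (simp add: ptolemy_swap)
    next
      assume "u \<noteq> c" "v \<noteq> d"
      then show ?thesis
        using \<open>ptolemy f a b u v\<close> ptolemy_glue[of f a b u v c d] A C cr by blast
    qed
  qed
  \<comment> \<open>\<open>main\<close> assumes that \<open>c\<close> comes before \<open>b\<close>
    and \<open>d\<close> after it; the opposite order follows by swapping \<open>c\<close> and
    \<open>d\<close>.\<close>
  have "p c < p b \<and> p b < p d \<or> p d < p b \<and> p b < p c"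
    using less.prems crosses_base[of c d b] i.less_n D_doubleton[OF less.prems(2)]
    by (auto simp: crosses_swap)
  then show ?case
    using main[of c d] main[of d c] less.prems by (auto simp: crosses_swap ptolemy_swap insert_commute)
qed

theorem theoremA:
  fixes n :: nat and D :: "nat set set" and f :: "nat set \<Rightarrow> 'k::psemifield"
  assumes "3 \<le> n" and "dissection n D"
  shows "weak_frieze n D f \<longleftrightarrow>
         (\<forall>\<alpha> < n. \<forall>\<beta> < n. \<alpha> \<noteq> \<beta> \<longrightarrow> f {\<alpha>, \<beta>} = ssum (fpath f) (Tpaths n D \<alpha> \<beta>))"
  using weak_frieze_Tpath_formula[OF assms(2)] Tpath_formula_ptolemy[OF assms(2)]
  unfolding weak_frieze_def ptolemy_def by blast

end
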